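(* Let $R$ be a ring. Then the following are equivalent: (1) $R$ is strongly 2-nil-clean. (2) Every element in $R$ is the sum of a 2-idempotent and a nilpotent that commute.
   Context: All rings are associative with an identity, not necessarily commutative. A ring $R$ is strongly 2-nil-clean if every element of $R$ is the sum of two idempotents and a nilpotent that (pairwise) commute. An element $e$ of a ring is a 2-idempotent if $e^2$ is an idempotent, i.e. $e^2=e^4$. *)

theory Defs
  imports "HOL-Algebra.Ring"
begin

definition idempotent_elem :: "('a, 'b) ring_scheme \<Rightarrow> 'a \<Rightarrow> bool" where
  "idempotent_elem R e \<longleftrightarrow> e \<in> carrier R \<and> e \<otimes>\<^bsub>R\<^esub> e = e"

definition two_idempotent_elem :: "('a, 'b) ring_scheme \<Rightarrow> 'a \<Rightarrow> bool" where
  "two_idempotent_elem R e \<longleftrightarrow> e \<in> carrier R \<and> idempotent_elem R (e [^]\<^bsub>R\<^esub> (2::nat))"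

definition nilpotent_elem :: "('a, 'b) ring_scheme \<Rightarrow> 'a \<Rightarrow> bool" where
  "nilpotent_elem R w \<longleftrightarrow> w \<in> carrier R \<and> (\<exists>n::nat. n \<ge> 1 \<and> w [^]\<^bsub>R\<^esub> n = \<zero>\<^bsub>R\<^esub>)"

definition commuting_elems :: "('a, 'b) ring_scheme \<Rightarrow> 'a \<Rightarrow> 'a \<Rightarrow> bool" where
  "commuting_elems R x y \<longleftrightarrow> x \<otimes>\<^bsub>R\<^esub> y = y \<otimes>\<^bsub>R\<^esub> x"

definition strongly_2_nil_clean :: "('a, 'b) ring_scheme \<Rightarrow> bool" where
  "strongly_2_nil_clean R \<longleftrightarrow>
    (\<forall>a \<in> carrier R. \<exists>e f w.
      idempotent_elem R e \<and> idempotent_elem R f \<and> nilpotent_elem R w \<and>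
      commuting_elems R e f \<and> commuting_elems R e w \<and> commuting_elems R f w \<and>
      a = e \<oplus>\<^bsub>R\<^esub> f \<oplus>\<^bsub>R\<^esub> w)"

end

theory Submission
  imports Defs "HOL-Algebra.Subrings" "HOL-Number_Theory.Cong" "HOL-Decision_Procs.Algebra_Aux"
begin

text \<open>
  In both directions a decomposition of \<open>a\<close> involves only pairwise commuting elements. They lie in a
  commutative subring, their double centralizer, so everything can be computed with commutative
  polynomial identities, and whatever is built inside that subring commutes again.

  Each of the two conditions forces 6 to be nilpotent: decompose \<open>-1\<close>, respectively 2, and eliminate
  the idempotents from the resulting equation
  (\<open>six_nilpotent_if_minus_one_2_nil_clean\<close>, \<open>six_nilpotent_if_two_decomposes\<close>).
  Hence \<open>6\<^sup>k = 0\<close> for some \<open>k\<close>, and the ring is a product of a factor in which 2 is nilpotent and one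
  in which 3 is nilpotent. The product need not be formed: by the Chinese remainder theorem there is
  an integer \<open>\<gamma>\<close> that acts as 0 on the first factor and as \<open>1/2\<close> on the second. Its two properties
  \<open>2\<gamma>\<^sup>2 = \<gamma>\<close> and \<open>\<gamma> + 1 = 3\<delta>\<close> are all that the computations use (\<open>ex_half_on_3_part\<close>).

  From two idempotents \<open>e\<close>, \<open>f\<close> to a 2-idempotent: the sum \<open>e + f\<close> is 1 on the symmetric difference
  of \<open>e\<close> and \<open>f\<close> and 2 on \<open>e f\<close>. Up to a nilpotent, 2 is 0 on the first factor and \<open>-1\<close> on the second,
  that is, \<open>-2\<gamma>\<close>. So \<open>e + f - (2 + 2\<gamma>) e f\<close> is a 2-idempotent, and the correction
  \<open>(2 + 2\<gamma>) e f = 6\<delta> e f\<close> is nilpotent.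

  From a 2-idempotent \<open>e\<close> to two idempotents: \<open>t = e\<^sup>3\<close> satisfies \<open>t\<^sup>3 = t\<close> and differs from \<open>e\<close> by an
  element of square 0. On the first factor \<open>t\<close> agrees with the idempotent \<open>t\<^sup>2 = e\<^sup>2\<close> up to a nilpotent.
  On the second, \<open>t\<close> is a difference of the orthogonal idempotents \<open>(t\<^sup>2 + t)/2\<close> and \<open>q = (t\<^sup>2 - t)/2\<close>,
  whose sum is \<open>t\<^sup>2\<close>, so that \<open>t = t\<^sup>2 - 2q\<close>, which is \<open>t\<^sup>2 + q\<close> up to the nilpotent \<open>3q\<close>. The idempotents
  \<open>e\<^sup>2\<close> and \<open>\<gamma> (e\<^sup>2 - e\<^sup>3)\<close> serve on both factors at once.
\<close>

section \<open>Commutative subrings containing given commuting elements\<close>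

definition centralizer :: "('a, 'b) ring_scheme \<Rightarrow> 'a set \<Rightarrow> 'a set" where
  "centralizer R S = {x \<in> carrier R. \<forall>s\<in>S. commuting_elems R x s}"

lemma (in ring) centralizer_subring:
  assumes "S \<subseteq> carrier R"
  shows "subring (centralizer R S) R"
proof (rule subringI)
  fix x y assume xy: "x \<in> centralizer R S" "y \<in> centralizer R S"
  show "x \<otimes> y \<in> centralizer R S"
  proof -
    have "x \<otimes> y \<otimes> s = s \<otimes> (x \<otimes> y)" if "s \<in> S" for s
    proof -
      have c: "x \<in> carrier R" "y \<in> carrier R" "s \<in> carrier R"
        and xs: "x \<otimes> s = s \<otimes> x" and ys: "y \<otimes> s = s \<otimes> y"
        using xy that assms by (auto simp: centralizer_def commuting_elems_def)
      have "x \<otimes> y \<otimes> s = x \<otimes> s \<otimes> y"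
        using c ys by (simp add: m_assoc)
      then show ?thesis
        using c xs by (simp add: m_assoc)
    qed
    then show ?thesis
      using xy by (simp add: centralizer_def commuting_elems_def)
  qed
next
  fix x assume "x \<in> centralizer R S"
  then show "\<ominus> x \<in> centralizer R S"
    using assms by (auto simp: centralizer_def commuting_elems_def l_minus r_minus subset_iff)
qed (use assms in \<open>auto simp: centralizer_def commuting_elems_def l_distr r_distr subset_iff\<close>)

text \<open>
  The double centralizer works: since \<open>S\<close> is commutative, it lies in its own centralizer, and taking
  centralizers reverses this inclusion, so the double centralizer is contained in the centralizer of
  \<open>S\<close>, with which it commutes.
\<close>

lemma (in ring) ex_commutative_subring:
  assumes S: "S \<subseteq> carrier R"
    and comm: "\<forall>x\<in>S. \<forall>y\<in>S. commuting_elems R x y"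
  obtains H where "S \<subseteq> H" "subring H R" "cring (R\<lparr>carrier := H\<rparr>)"
proof
  let ?C = "centralizer R S" and ?H = "centralizer R (centralizer R S)"
  show "S \<subseteq> ?H"
    using S by (auto simp: centralizer_def commuting_elems_def)
  have "S \<subseteq> ?C"
    using S comm by (auto simp: centralizer_def commuting_elems_def)
  then have "?H \<subseteq> ?C"
    by (auto simp: centralizer_def)
  show subring: "subring ?H R"
    by (rule centralizer_subring) (auto simp: centralizer_def)
  have "subcring ?H R"
    using subring
  proof (rule subcringI)
    fix x y assume "x \<in> ?H" "y \<in> ?H"
    with \<open>?H \<subseteq> ?C\<close> show "x \<otimes> y = y \<otimes> x"
      by (auto simp: centralizer_def commuting_elems_def)
  qed
  then show "cring (R\<lparr>carrier := ?H\<rparr>)"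
    using subcring_iff subringE(1)[OF subring] by simp
qed

section \<open>Nilpotent elements of a commutative ring\<close>

context cring
begin

lemma nilpotent_mult:
  assumes "nilpotent_elem R x" "y \<in> carrier R"
  shows "nilpotent_elem R (y \<otimes> x)"
  using assms by (fastforce simp: nilpotent_elem_def nat_pow_distrib)

lemma nilpotent_if_square:
  assumes "x \<in> carrier R" "nilpotent_elem R (x \<otimes> x)"
  shows "nilpotent_elem R x"
proof -
  obtain n :: nat where n: "n \<ge> 1" "(x \<otimes> x) [^] n = \<zero>"
    using assms(2) by (auto simp: nilpotent_elem_def)
  then have "x [^] (n + n) = \<zero>"
    using assms(1) by (simp add: nat_pow_distrib nat_pow_mult)
  with n(1) assms(1) show ?thesis
    unfolding nilpotent_elem_def by (intro conjI exI[of _ "n + n"]) auto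
qed

lemma nilpotent_add:
  assumes "nilpotent_elem R x" "nilpotent_elem R y"
  shows "nilpotent_elem R (x \<oplus> y)"
proof -
  obtain m n :: nat where m: "m \<ge> 1" "x [^] m = \<zero>" and n: "y [^] n = \<zero>"
    and [simp]: "x \<in> carrier R" "y \<in> carrier R"
    using assms by (auto simp: nilpotent_elem_def)
  have zero_x: "x [^] i = \<zero>" if "i \<ge> m" for i
    using nat_pow_mult[of x m "i - m"] m(2) that by simp
  have zero_y: "y [^] j = \<zero>" if "j \<ge> n" for j
    using nat_pow_mult[of y n "j - n"] n that by simp
  \<comment> \<open>Generalizing to a monomial factor makes the exponent of the sum the induction variable and
    avoids the binomial theorem: one factor \<open>x + y\<close> is distributed over the monomial at a time.\<close>
  have "x [^] i \<otimes> y [^] j \<otimes> (x \<oplus> y) [^] s = \<zero>" if "i + j + s \<ge> m + n" for i j s :: nat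
    using that
  proof (induction s arbitrary: i j)
    case 0
    then have "i \<ge> m \<or> j \<ge> n" by linarith
    then show ?case using zero_x zero_y by auto
  next
    case (Suc s)
    have cl: "x [^] i \<in> carrier R" "y [^] j \<in> carrier R" "(x \<oplus> y) [^] s \<in> carrier R"
      by auto
    have "x [^] i \<otimes> y [^] j \<otimes> (x \<oplus> y) [^] Suc s =
        x [^] Suc i \<otimes> y [^] j \<otimes> (x \<oplus> y) [^] s \<oplus> x [^] i \<otimes> y [^] Suc j \<otimes> (x \<oplus> y) [^] s"
      using cl by (simp add: l_distr r_distr m_ac)
    also have "\<dots> = \<zero>"
      using Suc.IH[of "Suc i" j] Suc.IH[of i "Suc j"] Suc.prems by simp
    finally show ?case .
  qed
  from this[of 0 0 "m + n"] m(1) show ?thesis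
    unfolding nilpotent_elem_def by (intro conjI exI[of _ "m + n"]) auto
qed

lemma nilpotent_uminus:
  assumes "nilpotent_elem R x"
  shows "nilpotent_elem R (\<ominus> x)"
proof -
  have x: "x \<in> carrier R"
    using assms by (simp add: nilpotent_elem_def)
  then show ?thesis
    using nilpotent_mult[OF assms, of "\<ominus> \<one>"] by (simp add: l_minus)
qed

lemma nilpotent_if_add_nilpotent:
  assumes "x \<in> carrier R" "nilpotent_elem R y" "nilpotent_elem R (x \<oplus> y)"
  shows "nilpotent_elem R x"
proof -
  have "y \<in> carrier R"
    using assms(2) by (simp add: nilpotent_elem_def)
  then have "x = (x \<oplus> y) \<oplus> \<ominus> y"
    using assms(1) by (simp add: a_assoc r_neg)
  then show ?thesis
    using nilpotent_add[OF assms(3) nilpotent_uminus[OF assms(2)]] by simp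
qed

section \<open>Nilpotency of 6\<close>

text \<open>
  The element \<open>s = 1 + e + f = -w\<close> is nilpotent and takes the values 1, 2 and 3 on the four products of
  \<open>e\<close> or \<open>1 - e\<close> with \<open>f\<close> or \<open>1 - f\<close>, so 6 is a multiple of it. On these products the cofactor is 6, 3, 3
  and 2, that is, \<open>6 - 3e - 3f + 2 e f\<close>.
\<close>

lemma six_nilpotent_if_minus_one_2_nil_clean:
  assumes "idempotent_elem R e" "idempotent_elem R f" "nilpotent_elem R w"
    and sum: "\<one> \<oplus> (e \<oplus> f \<oplus> w) = \<zero>"
  shows "nilpotent_elem R \<guillemotleft>6\<guillemotright>"
proof -
  have [simp]: "e \<in> carrier R" "f \<in> carrier R" "w \<in> carrier R"
    using assms by (auto simp: idempotent_elem_def nilpotent_elem_def)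
  have [simp]: "e \<otimes> e = e" "f \<otimes> f = f"
    using assms(1,2) by (auto simp: idempotent_elem_def)
  have [simp]: "e \<otimes> (e \<otimes> x) = e \<otimes> x" "f \<otimes> (f \<otimes> x) = f \<otimes> x" if "x \<in> carrier R" for x
    using that by (simp_all flip: m_assoc)
  define s where "s = \<one> \<oplus> e \<oplus> f"
  have [simp]: "s \<in> carrier R" by (simp add: s_def)
  have "s \<oplus> w = \<zero>" using sum by (simp add: s_def a_assoc)
  then have "s = \<ominus> w" by (simp add: eq_neg_iff_add_eq_0)
  then have s: "nilpotent_elem R s"
    using nilpotent_uminus[OF assms(3)] by simp
  have six: "\<guillemotleft>6\<guillemotright> = \<one> \<oplus> \<one> \<oplus> \<one> \<oplus> \<one> \<oplus> \<one> \<oplus> \<one>"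
    by (simp add: of_integer_def eval_nat_numeral a_assoc)
  \<comment> \<open>The identity \<open>6 = s (6 - 3e - 3f + 2 e f)\<close> with the negative terms moved to the other side, so that
    expanding into monomials proves it without any cancellation.\<close>
  define a where "a = (e \<oplus> f) \<oplus> (e \<oplus> f) \<oplus> (e \<oplus> f)"
  define b where "b = \<guillemotleft>6\<guillemotright> \<oplus> (e \<otimes> f \<oplus> e \<otimes> f)"
  have ab: "a \<in> carrier R" "b \<in> carrier R" by (simp_all add: a_def b_def)
  have "\<guillemotleft>6\<guillemotright> \<oplus> a \<otimes> s = b \<otimes> s"
    unfolding six a_def b_def s_def by (simp add: l_distr r_distr m_ac a_ac)
  then show ?thesis
    using nilpotent_if_add_nilpotent[OF _ nilpotent_mult[OF s ab(1)], of "\<guillemotleft>6\<guillemotright>"]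
      nilpotent_mult[OF s ab(2)] by simp
qed

lemma two_idempotent_power4:
  assumes "two_idempotent_elem R e"
  shows "e [^] (4::nat) = e [^] (2::nat)"
  using assms nat_pow_mult[of e 2 2]
  by (simp add: two_idempotent_elem_def idempotent_elem_def)

lemma power_add_eq_power_add_multiple:
  assumes [simp]: "x \<in> carrier R" "w \<in> carrier R"
  shows "\<exists>z\<in>carrier R. (x \<oplus> w) [^] (n::nat) = x [^] n \<oplus> z \<otimes> w"
proof (induction n)
  case 0
  then show ?case by (auto intro: bexI[of _ "\<zero>"])
next
  case (Suc n)
  then obtain z where [simp]: "z \<in> carrier R" and z: "(x \<oplus> w) [^] n = x [^] n \<oplus> z \<otimes> w"
    by blast
  have "(x \<oplus> w) [^] Suc n = (x [^] n \<oplus> z \<otimes> w) \<otimes> (x \<oplus> w)"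
    by (simp add: z)
  also have "\<dots> = x [^] Suc n \<oplus> (x [^] n \<oplus> z \<otimes> (x \<oplus> w)) \<otimes> w"
    by (simp add: l_distr r_distr m_ac a_ac)
  finally have "(x \<oplus> w) [^] Suc n = x [^] Suc n \<oplus> (x [^] n \<oplus> z \<otimes> (x \<oplus> w)) \<otimes> w" .
  then show ?case
    by (intro bexI[of _ "x [^] n \<oplus> z \<otimes> (x \<oplus> w)"]) simp_all
qed

text \<open>
  Modulo multiples of \<open>w\<close>, \<open>2\<^sup>n\<close> is \<open>e\<^sup>n\<close>. Hence \<open>e\<^sup>4 = e\<^sup>2\<close> makes \<open>2\<^sup>4 - 2\<^sup>2 = 12\<close> nilpotent, and with it
  \<open>6\<^sup>2 = 3 \<cdot> 12\<close>.
\<close>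

lemma six_nilpotent_if_two_decomposes:
  assumes "two_idempotent_elem R e" "nilpotent_elem R w" and sum: "\<one> \<oplus> \<one> = e \<oplus> w"
  shows "nilpotent_elem R \<guillemotleft>6\<guillemotright>"
proof -
  have [simp]: "e \<in> carrier R" "w \<in> carrier R"
    using assms by (auto simp: two_idempotent_elem_def nilpotent_elem_def)
  have two: "e \<oplus> w = \<guillemotleft>2\<guillemotright>"
    by (simp add: of_int_2 sum)
  obtain y where y: "y \<in> carrier R" "(e \<oplus> w) [^] (2::nat) = e [^] (2::nat) \<oplus> y \<otimes> w"
    using power_add_eq_power_add_multiple[of e w 2] by auto
  obtain z where z: "z \<in> carrier R" "(e \<oplus> w) [^] (4::nat) = e [^] (2::nat) \<oplus> z \<otimes> w"
    using power_add_eq_power_add_multiple[of e w 4] two_idempotent_power4[OF assms(1)] by auto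
  have "\<guillemotleft>12\<guillemotright> \<oplus> \<guillemotleft>2\<guillemotright> [^] (2::nat) = \<guillemotleft>2\<guillemotright> [^] (4::nat)"
    by (simp flip: of_int_power of_int_add)
  then have "e [^] (2::nat) \<oplus> (\<guillemotleft>12\<guillemotright> \<oplus> y \<otimes> w) = e [^] (2::nat) \<oplus> z \<otimes> w"
    using y z by (simp add: two a_ac)
  then have "\<guillemotleft>12\<guillemotright> \<oplus> y \<otimes> w = z \<otimes> w"
    using y(1) z(1) by simp
  then have "nilpotent_elem R \<guillemotleft>12\<guillemotright>"
    using nilpotent_if_add_nilpotent[of "\<guillemotleft>12\<guillemotright>" "y \<otimes> w"] nilpotent_mult[OF assms(2)] y(1) z(1)
    by simp
  then have "nilpotent_elem R (\<guillemotleft>3\<guillemotright> \<otimes> \<guillemotleft>12\<guillemotright>)"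
    by (rule nilpotent_mult) simp
  then have "nilpotent_elem R (\<guillemotleft>6\<guillemotright> \<otimes> \<guillemotleft>6\<guillemotright>)"
    by (simp flip: of_int_mult)
  then show ?thesis
    by (rule nilpotent_if_square[rotated]) simp
qed

section \<open>Half the idempotent of the 3-primary part\<close>

text \<open>
  Let \<open>6\<^sup>k = 0\<close>. The elements \<open>\<gamma>\<close> and \<open>\<delta>\<close> are the images of integers \<open>c\<close> and \<open>d\<close> such that \<open>c\<close> is 0 modulo
  \<open>2\<^sup>k\<close> and the inverse of 2 modulo \<open>3\<^sup>k\<close>. Then \<open>6\<^sup>k\<close> divides \<open>c (2c - 1)\<close>, and \<open>c\<close> is \<open>-1\<close> modulo 3. The
  element \<open>2\<gamma>\<close> is the idempotent that projects to the part of the ring where 3 is nilpotent.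
\<close>

lemma ex_half_on_3_part:
  assumes "nilpotent_elem R \<guillemotleft>6\<guillemotright>"
  obtains \<gamma> \<delta> where "\<gamma> \<in> carrier R" "\<delta> \<in> carrier R"
    "\<gamma> \<oplus> \<one> = \<guillemotleft>3\<guillemotright> \<otimes> \<delta>" "\<guillemotleft>2\<guillemotright> \<otimes> \<gamma> [^] (2::nat) = \<gamma>"
proof -
  obtain k :: nat where k: "k \<ge> 1" "\<guillemotleft>6\<guillemotright> [^] k = \<zero>"
    using assms by (auto simp: nilpotent_elem_def)
  obtain x :: int where x: "[2 ^ (k + 1) * x = 1] (mod 3 ^ k)"
    using cong_solve_coprime_int[of "2 ^ (k + 1)" "3 ^ k"] by auto
  \<comment> \<open>The factor 2 beyond \<open>2\<^sup>k\<close> in the choice of \<open>x\<close> makes \<open>2c\<close>, not \<open>c\<close>, congruent to 1.\<close>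
  define c where "c = 2 ^ k * x"
  have d3: "3 ^ k dvd 2 * c - 1"
    using x by (simp add: c_def cong_iff_dvd_diff mult.assoc)
  have "(2 ^ k * 3 ^ k :: int) dvd c * (2 * c - 1)"
    using d3 by (intro mult_dvd_mono) (simp_all add: c_def)
  then have "6 ^ k dvd c * (2 * c - 1)"
    by (simp flip: power_mult_distrib)
  then obtain b where b: "c * (2 * c - 1) = 6 ^ k * b" by (elim dvdE)
  have "(3::int) dvd 2 * c - 1"
    using d3 k(1) by (meson dvd_power dvd_trans less_le_trans zero_less_one)
  then have "3 dvd c + 1" by presburger
  then obtain d where d: "c + 1 = 3 * d" by (elim dvdE)
  show ?thesis
  proof
    show "\<guillemotleft>c\<guillemotright> \<in> carrier R" "\<guillemotleft>d\<guillemotright> \<in> carrier R" by simp_all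
    show "\<guillemotleft>c\<guillemotright> \<oplus> \<one> = \<guillemotleft>3\<guillemotright> \<otimes> \<guillemotleft>d\<guillemotright>"
      using arg_cong[OF d, of "of_integer R"] by simp
    have "2 * c ^ 2 = c + 6 ^ k * b"
      using b by (simp add: algebra_simps monoid_mult_class.power2_eq_square)
    from arg_cong[OF this, of "of_integer R"]
    show "\<guillemotleft>2\<guillemotright> \<otimes> \<guillemotleft>c\<guillemotright> [^] (2::nat) = \<guillemotleft>c\<guillemotright>"
      by (simp only: of_int_mult of_int_add of_int_power k(2)) simp
  qed
qed

section \<open>Passing between the two decompositions\<close>

lemma idempotent_mult:
  assumes "idempotent_elem R p" "idempotent_elem R q"
  shows "idempotent_elem R (p \<otimes> q)"
proof -
  have [simp]: "p \<in> carrier R" "q \<in> carrier R" and pq: "p \<otimes> p = p" "q \<otimes> q = q"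
    using assms by (auto simp: idempotent_elem_def)
  have "p \<otimes> q \<otimes> (p \<otimes> q) = (p \<otimes> p) \<otimes> (q \<otimes> q)" by (simp add: m_ac)
  then show ?thesis by (simp add: idempotent_elem_def pq)
qed

lemma idempotent_complement:
  assumes "idempotent_elem R p"
  shows "idempotent_elem R (\<one> \<ominus> p)" and "p \<otimes> (\<one> \<ominus> p) = \<zero>"
proof -
  have [simp]: "p \<in> carrier R" and pp: "p \<otimes> p = p"
    using assms by (auto simp: idempotent_elem_def)
  show orth: "p \<otimes> (\<one> \<ominus> p) = \<zero>"
    by (simp add: minus_eq r_distr r_minus pp r_neg)
  have "(\<one> \<ominus> p) \<otimes> (\<one> \<ominus> p) = (\<one> \<ominus> p) \<ominus> p \<otimes> (\<one> \<ominus> p)"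
    by (simp add: minus_eq l_distr l_minus)
  then show "idempotent_elem R (\<one> \<ominus> p)"
    by (simp add: idempotent_elem_def orth)
qed

lemma idempotent_add_orthogonal:
  assumes "idempotent_elem R p" "idempotent_elem R q" "p \<otimes> q = \<zero>"
  shows "idempotent_elem R (p \<oplus> q)"
  using assms m_comm[of q p] by (simp add: idempotent_elem_def l_distr r_distr)

lemma two_idempotent_diff_orthogonal:
  assumes "idempotent_elem R p" "idempotent_elem R q" "p \<otimes> q = \<zero>"
  shows "two_idempotent_elem R (p \<ominus> q)"
proof -
  have "(p \<ominus> q) \<otimes> (p \<ominus> q) = p \<oplus> q"
    using assms m_comm[of q p]
    by (simp add: idempotent_elem_def minus_eq l_distr r_distr l_minus r_minus)
  then show ?thesis
    using assms idempotent_add_orthogonal[OF assms]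
    by (simp add: two_idempotent_elem_def power2_eq_square idempotent_elem_def)
qed

text \<open>
  The sum \<open>e + f\<close> equals \<open>a + b + 2c\<close> for the orthogonal idempotents \<open>a = e (1 - f)\<close>, \<open>b = f (1 - e)\<close> and
  \<open>c = e f\<close>. Replacing the coefficient 2 of \<open>c\<close> by \<open>-2\<gamma>\<close>, the negative of an idempotent, gives a
  2-idempotent, and changes the sum by a multiple of \<open>2 (\<gamma> + 1) = 6\<delta>\<close>.
\<close>

lemma two_idempotent_plus_nilpotent_if_two_idempotents:
  assumes e: "idempotent_elem R e" and f: "idempotent_elem R f" and "nilpotent_elem R w"
    and six: "nilpotent_elem R \<guillemotleft>6\<guillemotright>"
  obtains g v where "two_idempotent_elem R g" "nilpotent_elem R v" "e \<oplus> f \<oplus> w = g \<oplus> v"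
proof -
  obtain \<gamma> \<delta> where gd[simp]: "\<gamma> \<in> carrier R" "\<delta> \<in> carrier R"
    and d: "\<gamma> \<oplus> \<one> = \<guillemotleft>3\<guillemotright> \<otimes> \<delta>" and g: "\<guillemotleft>2\<guillemotright> \<otimes> \<gamma> [^] (2::nat) = \<gamma>"
    using ex_half_on_3_part[OF six] .
  have [simp]: "e \<in> carrier R" "f \<in> carrier R" "w \<in> carrier R"
    using assms by (auto simp: idempotent_elem_def nilpotent_elem_def)
  define a b c where "a = e \<otimes> (\<one> \<ominus> f)" and "b = f \<otimes> (\<one> \<ominus> e)" and "c = e \<otimes> f"
  define q where "q = \<guillemotleft>2\<guillemotright> \<otimes> \<gamma> \<otimes> c"
  have [simp]: "a \<in> carrier R" "b \<in> carrier R" "c \<in> carrier R" "q \<in> carrier R"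
    by (simp_all add: a_def b_def c_def q_def)
  have abc: "idempotent_elem R a" "idempotent_elem R b" "idempotent_elem R c"
    unfolding a_def b_def c_def by (intro idempotent_mult idempotent_complement(1) e f)+
  have orth: "a \<otimes> b = \<zero>" "a \<otimes> c = \<zero>" "b \<otimes> c = \<zero>"
  proof -
    have "a \<otimes> b = (e \<otimes> (\<one> \<ominus> e)) \<otimes> (f \<otimes> (\<one> \<ominus> f))"
      by (simp add: a_def b_def m_ac)
    then show "a \<otimes> b = \<zero>" by (simp add: idempotent_complement(2)[OF e])
    have "a \<otimes> c = (e \<otimes> e) \<otimes> (f \<otimes> (\<one> \<ominus> f))"
      by (simp add: a_def c_def m_ac)
    then show "a \<otimes> c = \<zero>" by (simp add: idempotent_complement(2)[OF f])
    have "b \<otimes> c = (f \<otimes> f) \<otimes> (e \<otimes> (\<one> \<ominus> e))"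
      by (simp add: b_def c_def m_ac)
    then show "b \<otimes> c = \<zero>" by (simp add: idempotent_complement(2)[OF e])
  qed
  have "(\<guillemotleft>2\<guillemotright> \<otimes> \<gamma>) \<otimes> (\<guillemotleft>2\<guillemotright> \<otimes> \<gamma>) = \<guillemotleft>2\<guillemotright> \<otimes> (\<guillemotleft>2\<guillemotright> \<otimes> \<gamma> [^] (2::nat))"
    by (simp add: power2_eq_square m_ac)
  then have "idempotent_elem R (\<guillemotleft>2\<guillemotright> \<otimes> \<gamma>)"
    by (simp add: g idempotent_elem_def)
  then have q: "idempotent_elem R q"
    unfolding q_def by (rule idempotent_mult[OF _ abc(3)])
  have "(a \<oplus> b) \<otimes> q = (\<guillemotleft>2\<guillemotright> \<otimes> \<gamma>) \<otimes> ((a \<oplus> b) \<otimes> c)"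
    unfolding q_def by (simp add: m_ac)
  also have "\<dots> = \<zero>"
    by (simp add: l_distr orth)
  finally have t: "two_idempotent_elem R ((a \<oplus> b) \<ominus> q)"
    by (intro two_idempotent_diff_orthogonal idempotent_add_orthogonal abc orth q)
  have "e \<otimes> (\<one> \<ominus> f) \<oplus> e \<otimes> f = e" "f \<otimes> (\<one> \<ominus> e) \<oplus> e \<otimes> f = f"
    by (simp_all add: minus_eq r_distr r_minus a_assoc l_neg m_comm[of f e])
  then have ef: "e = a \<oplus> c" "f = b \<oplus> c"
    by (simp_all add: a_def b_def c_def)
  have "c \<oplus> c \<oplus> q = \<guillemotleft>2\<guillemotright> \<otimes> c \<otimes> (\<gamma> \<oplus> \<one>)"
    unfolding q_def by (simp add: mult2 r_distr m_ac a_ac)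
  also have "\<dots> = (c \<otimes> \<delta>) \<otimes> (\<guillemotleft>2\<guillemotright> \<otimes> \<guillemotleft>3\<guillemotright>)"
    unfolding d by (simp add: m_ac)
  also have "\<dots> = (c \<otimes> \<delta>) \<otimes> \<guillemotleft>6\<guillemotright>"
    by (simp flip: of_int_mult)
  finally have "nilpotent_elem R (c \<oplus> c \<oplus> q)"
    using nilpotent_mult[OF six, of "c \<otimes> \<delta>"] by simp
  then have v: "nilpotent_elem R (w \<oplus> (c \<oplus> c \<oplus> q))"
    by (rule nilpotent_add[OF assms(3)])
  have "((a \<oplus> b) \<ominus> q) \<oplus> (w \<oplus> (c \<oplus> c \<oplus> q)) = (a \<oplus> b \<oplus> w \<oplus> c \<oplus> c) \<oplus> (\<ominus> q \<oplus> q)"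
    by (simp only: minus_eq) (simp add: a_ac del: l_neg)
  also have "\<dots> = a \<oplus> b \<oplus> w \<oplus> c \<oplus> c"
    by (subst l_neg) simp_all
  also have "\<dots> = e \<oplus> f \<oplus> w"
    unfolding ef by (simp add: a_ac)
  finally show ?thesis
    using that[OF t v] by simp
qed

text \<open>
  With \<open>g = e\<^sup>2\<close>, \<open>t = e\<^sup>3\<close> and \<open>y = g - t\<close>, the idempotents are \<open>g\<close> and \<open>q = \<gamma> y\<close>. The second is idempotent
  because \<open>y\<^sup>2 = 2y\<close> and \<open>2\<gamma>\<^sup>2 = \<gamma>\<close>. The nilpotent part is \<open>v = w + r - (q + y)\<close>, where \<open>r = e - t\<close> has square
  0 and \<open>q + y = (\<gamma> + 1) y = 3\<delta> y\<close>; in the square of \<open>q + y\<close> the equation \<open>y\<^sup>2 = 2y\<close> supplies the factor 2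
  that completes 3 to 6.
\<close>

lemma two_idempotents_plus_nilpotent_if_two_idempotent:
  assumes two_idem: "two_idempotent_elem R e" and "nilpotent_elem R w"
    and six: "nilpotent_elem R \<guillemotleft>6\<guillemotright>"
  obtains p q v where "idempotent_elem R p" "idempotent_elem R q" "nilpotent_elem R v"
    "e \<oplus> w = p \<oplus> q \<oplus> v"
proof -
  obtain \<gamma> \<delta> where gd[simp]: "\<gamma> \<in> carrier R" "\<delta> \<in> carrier R"
    and d: "\<gamma> \<oplus> \<one> = \<guillemotleft>3\<guillemotright> \<otimes> \<delta>" and half: "\<guillemotleft>2\<guillemotright> \<otimes> \<gamma> [^] (2::nat) = \<gamma>"
    using ex_half_on_3_part[OF six] .
  have [simp]: "e \<in> carrier R" "w \<in> carrier R"
    using assms by (auto simp: two_idempotent_elem_def nilpotent_elem_def)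
  define g t where "g = e \<otimes> e" and "t = e \<otimes> g"
  define r y where "r = e \<ominus> t" and "y = g \<ominus> t"
  define q where "q = \<gamma> \<otimes> y"
  have [simp]: "g \<in> carrier R" "t \<in> carrier R" "r \<in> carrier R" "y \<in> carrier R" "q \<in> carrier R"
    by (simp_all add: g_def t_def r_def y_def q_def)
  have g: "idempotent_elem R g"
    using two_idem by (simp add: two_idempotent_elem_def power2_eq_square g_def)
  then have gg: "g \<otimes> g = g" by (simp add: idempotent_elem_def)
  have gt: "g \<otimes> t = t"
    using gg by (simp add: t_def m_lcomm)
  have "t \<otimes> t = g \<otimes> (g \<otimes> g)"
    unfolding t_def by (simp add: g_def m_ac)
  then have tt: "t \<otimes> t = g" by (simp add: gg)
  have "y \<otimes> y = y \<oplus> y"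
    by (simp add: y_def minus_eq l_distr r_distr l_minus r_minus gg tt gt m_comm[of t g]
        minus_add a_ac)
  then have yy: "y \<otimes> y = \<guillemotleft>2\<guillemotright> \<otimes> y" by (simp add: mult2)
  have "q \<otimes> q = \<gamma> [^] (2::nat) \<otimes> (y \<otimes> y)"
    by (simp add: q_def power2_eq_square m_ac)
  also have "\<dots> = (\<guillemotleft>2\<guillemotright> \<otimes> \<gamma> [^] (2::nat)) \<otimes> y"
    unfolding yy by (simp add: m_ac)
  finally have q: "idempotent_elem R q"
    unfolding half by (simp add: idempotent_elem_def flip: q_def)
  have "r = e \<otimes> (\<one> \<ominus> g)"
    by (simp add: r_def t_def minus_eq r_distr r_minus)
  then have "r \<otimes> r = (g \<otimes> (\<one> \<ominus> g)) \<otimes> (\<one> \<ominus> g)"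
    by (simp add: g_def m_ac)
  then have "r \<otimes> r = \<zero>"
    by (simp add: idempotent_complement(2)[OF g])
  then have r: "nilpotent_elem R r"
    unfolding nilpotent_elem_def
    by (intro conjI exI[of _ "2::nat"]) (simp_all add: power2_eq_square)
  have qy: "q \<oplus> y = \<guillemotleft>3\<guillemotright> \<otimes> \<delta> \<otimes> y"
    unfolding d[symmetric] by (simp add: q_def l_distr)
  have "(q \<oplus> y) \<otimes> (q \<oplus> y) = \<guillemotleft>3\<guillemotright> \<otimes> \<delta> [^] (2::nat) \<otimes> \<guillemotleft>3\<guillemotright> \<otimes> (y \<otimes> y)"
    unfolding qy by (simp add: power2_eq_square m_ac)
  also have "\<dots> = (\<guillemotleft>3\<guillemotright> \<otimes> \<delta> [^] (2::nat) \<otimes> y) \<otimes> (\<guillemotleft>3\<guillemotright> \<otimes> \<guillemotleft>2\<guillemotright>)"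
    unfolding yy by (simp add: m_ac)
  also have "\<dots> = (\<guillemotleft>3\<guillemotright> \<otimes> \<delta> [^] (2::nat) \<otimes> y) \<otimes> \<guillemotleft>6\<guillemotright>"
    by (simp flip: of_int_mult)
  finally have "nilpotent_elem R ((q \<oplus> y) \<otimes> (q \<oplus> y))"
    using nilpotent_mult[OF six, of "\<guillemotleft>3\<guillemotright> \<otimes> \<delta> [^] (2::nat) \<otimes> y"] by simp
  then have u: "nilpotent_elem R (q \<oplus> y)"
    by (rule nilpotent_if_square[rotated]) simp
  define v where "v = w \<oplus> (r \<oplus> \<ominus> (q \<oplus> y))"
  have [simp]: "v \<in> carrier R" by (simp add: v_def)
  have v: "nilpotent_elem R v"
    unfolding v_def by (rule nilpotent_add[OF assms(2) nilpotent_add[OF r nilpotent_uminus[OF u]]])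
  \<comment> \<open>The decomposition is checked after adding \<open>y\<close> to both sides and writing \<open>e\<close> and \<open>g\<close> as sums, which
    leaves no negative terms.\<close>
  have e_eq: "e = t \<oplus> r" and g_eq: "g = t \<oplus> y"
    by (simp_all add: r_def y_def minus_eq a_lcomm[of t] r_neg)
  have "(q \<oplus> y) \<oplus> v = (w \<oplus> r) \<oplus> ((q \<oplus> y) \<oplus> \<ominus> (q \<oplus> y))"
    unfolding v_def by (simp add: a_ac del: r_neg minus_add)
  then have v_eq: "(q \<oplus> y) \<oplus> v = w \<oplus> r" by (simp add: r_neg)
  have "y \<oplus> (g \<oplus> q \<oplus> v) = g \<oplus> ((q \<oplus> y) \<oplus> v)"
    by (simp add: a_ac)
  also have "\<dots> = (t \<oplus> y) \<oplus> (w \<oplus> r)"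
    unfolding v_eq by (simp flip: g_eq)
  also have "\<dots> = y \<oplus> ((t \<oplus> r) \<oplus> w)"
    by (simp add: a_ac)
  also have "\<dots> = y \<oplus> (e \<oplus> w)"
    by (simp flip: e_eq)
  finally have "e \<oplus> w = g \<oplus> q \<oplus> v" by simp
  then show ?thesis
    by (rule that[OF g q v])
qed

end

section \<open>Reduction to the commutative case\<close>

lemma of_integer_carrier_update_6: "\<guillemotleft>6\<guillemotright>\<^bsub>R\<lparr>carrier := H\<rparr>\<^esub> = \<guillemotleft>6\<guillemotright>\<^bsub>R\<^esub>"
  by (simp add: of_integer_def of_natural_def)

lemma (in ring) elem_carrier_update:
  assumes "subring H R"
  defines "K \<equiv> R\<lparr>carrier := H\<rparr>"
  shows "idempotent_elem K x \<longleftrightarrow> x \<in> H \<and> idempotent_elem R x"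
    and "nilpotent_elem K x \<longleftrightarrow> x \<in> H \<and> nilpotent_elem R x"
    and "two_idempotent_elem K x \<longleftrightarrow> x \<in> H \<and> two_idempotent_elem R x"
proof -
  have H: "x \<in> carrier R" "x \<otimes> x \<in> H" if "x \<in> H"
    using subringE(1,6)[OF assms(1)] that by auto
  have pow: "y [^]\<^bsub>K\<^esub> n = y [^] n" for y and n :: nat
    unfolding K_def by (rule nat_pow_consistent[symmetric])
  show "idempotent_elem K x \<longleftrightarrow> x \<in> H \<and> idempotent_elem R x"
    and "nilpotent_elem K x \<longleftrightarrow> x \<in> H \<and> nilpotent_elem R x"
    and "two_idempotent_elem K x \<longleftrightarrow> x \<in> H \<and> two_idempotent_elem R x"
    unfolding idempotent_elem_def nilpotent_elem_def two_idempotent_elem_def pow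
    using H by (auto simp: K_def power2_eq_square)
qed

lemma (in ring) six_nilpotent_if_strongly_2_nil_clean:
  assumes "strongly_2_nil_clean R"
  shows "nilpotent_elem R \<guillemotleft>6\<guillemotright>"
proof -
  obtain e f w where efw: "idempotent_elem R e" "idempotent_elem R f" "nilpotent_elem R w"
    and comm: "commuting_elems R e f" "commuting_elems R e w" "commuting_elems R f w"
    and sum: "\<ominus> \<one> = e \<oplus> f \<oplus> w"
    using assms unfolding strongly_2_nil_clean_def by (meson a_inv_closed one_closed)
  have S: "{e, f, w} \<subseteq> carrier R"
    using efw by (auto simp: idempotent_elem_def nilpotent_elem_def)
  have "\<forall>x\<in>{e, f, w}. \<forall>y\<in>{e, f, w}. commuting_elems R x y"
    using comm by (auto simp: commuting_elems_def)
  then obtain H where H: "{e, f, w} \<subseteq> H" "subring H R" "cring (R\<lparr>carrier := H\<rparr>)"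
    using ex_commutative_subring[OF S] by blast
  have "\<one> \<oplus> (e \<oplus> f \<oplus> w) = \<zero>"
    by (simp flip: sum add: r_neg)
  then have "nilpotent_elem (R\<lparr>carrier := H\<rparr>) \<guillemotleft>6\<guillemotright>\<^bsub>R\<lparr>carrier := H\<rparr>\<^esub>"
    using cring.six_nilpotent_if_minus_one_2_nil_clean[OF H(3), of e f w] H(1) efw
    by (simp add: elem_carrier_update[OF H(2)])
  then show ?thesis
    by (simp add: elem_carrier_update[OF H(2)] of_integer_carrier_update_6)
qed

lemma (in ring) six_nilpotent_if_two_idempotent_plus_nilpotent:
  assumes "\<forall>a \<in> carrier R. \<exists>e w.
      two_idempotent_elem R e \<and> nilpotent_elem R w \<and> commuting_elems R e w \<and> a = e \<oplus> w"
  shows "nilpotent_elem R \<guillemotleft>6\<guillemotright>"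
proof -
  obtain e w where ew: "two_idempotent_elem R e" "nilpotent_elem R w"
    and comm: "commuting_elems R e w" and sum: "\<one> \<oplus> \<one> = e \<oplus> w"
    using assms by (meson add.m_closed one_closed)
  have S: "{e, w} \<subseteq> carrier R"
    using ew by (auto simp: two_idempotent_elem_def nilpotent_elem_def)
  have "\<forall>x\<in>{e, w}. \<forall>y\<in>{e, w}. commuting_elems R x y"
    using comm by (auto simp: commuting_elems_def)
  then obtain H where H: "{e, w} \<subseteq> H" "subring H R" "cring (R\<lparr>carrier := H\<rparr>)"
    using ex_commutative_subring[OF S] by blast
  have "nilpotent_elem (R\<lparr>carrier := H\<rparr>) \<guillemotleft>6\<guillemotright>\<^bsub>R\<lparr>carrier := H\<rparr>\<^esub>"
    using cring.six_nilpotent_if_two_decomposes[OF H(3), of e w] H(1) ew sum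
    by (simp add: elem_carrier_update[OF H(2)])
  then show ?thesis
    by (simp add: elem_carrier_update[OF H(2)] of_integer_carrier_update_6)
qed

theorem corollary3p3:
  fixes R :: "('a, 'b) ring_scheme"
  assumes "ring R"
  shows "strongly_2_nil_clean R \<longleftrightarrow>
    (\<forall>a \<in> carrier R. \<exists>e w.
      two_idempotent_elem R e \<and> nilpotent_elem R w \<and> commuting_elems R e w \<and>
      a = e \<oplus>\<^bsub>R\<^esub> w)"
    (is "_ \<longleftrightarrow> ?decomposable")
proof
  interpret ring R by fact
  assume clean: "strongly_2_nil_clean R"
  show ?decomposable
  proof
    fix a assume "a \<in> carrier R"
    then obtain e f w
      where efw: "idempotent_elem R e" "idempotent_elem R f" "nilpotent_elem R w"
      and comm: "commuting_elems R e f" "commuting_elems R e w" "commuting_elems R f w"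
      and a: "a = e \<oplus>\<^bsub>R\<^esub> f \<oplus>\<^bsub>R\<^esub> w"
      using clean unfolding strongly_2_nil_clean_def by meson
    have S: "{e, f, w} \<subseteq> carrier R"
      using efw by (auto simp: idempotent_elem_def nilpotent_elem_def)
    have "\<forall>x\<in>{e, f, w}. \<forall>y\<in>{e, f, w}. commuting_elems R x y"
      using comm by (auto simp: commuting_elems_def)
    then obtain H where H: "{e, f, w} \<subseteq> H" "subring H R" "cring (R\<lparr>carrier := H\<rparr>)"
      using ex_commutative_subring[OF S] by blast
    note transfer = elem_carrier_update[OF H(2)] of_integer_carrier_update_6
    have "\<guillemotleft>6\<guillemotright>\<^bsub>R\<^esub> \<in> H"
      using ring.of_int_closed[OF cring.axioms(1)[OF H(3)], of 6]
      by (simp add: of_integer_carrier_update_6)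
    then obtain g v where gv: "two_idempotent_elem (R\<lparr>carrier := H\<rparr>) g"
        "nilpotent_elem (R\<lparr>carrier := H\<rparr>) v" "a = g \<oplus>\<^bsub>R\<^esub> v"
      using cring.two_idempotent_plus_nilpotent_if_two_idempotents[OF H(3), of e f w] H(1) efw a
        six_nilpotent_if_strongly_2_nil_clean[OF clean]
      by (auto simp: transfer)
    then have "commuting_elems R g v"
      using comm_monoid.m_comm[OF cring.axioms(2)[OF H(3)], of g v]
      by (simp add: transfer commuting_elems_def)
    with gv show "\<exists>g v. two_idempotent_elem R g \<and> nilpotent_elem R v \<and>
        commuting_elems R g v \<and> a = g \<oplus>\<^bsub>R\<^esub> v"
      by (auto simp: transfer)
  qed
next
  interpret ring R by fact
  assume dec: ?decomposable
  show "strongly_2_nil_clean R"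
    unfolding strongly_2_nil_clean_def
  proof
    fix a assume "a \<in> carrier R"
    then obtain e w where ew: "two_idempotent_elem R e" "nilpotent_elem R w"
      and comm: "commuting_elems R e w" and a: "a = e \<oplus>\<^bsub>R\<^esub> w"
      using dec by meson
    have S: "{e, w} \<subseteq> carrier R"
      using ew by (auto simp: two_idempotent_elem_def nilpotent_elem_def)
    have "\<forall>x\<in>{e, w}. \<forall>y\<in>{e, w}. commuting_elems R x y"
      using comm by (auto simp: commuting_elems_def)
    then obtain H where H: "{e, w} \<subseteq> H" "subring H R" "cring (R\<lparr>carrier := H\<rparr>)"
      using ex_commutative_subring[OF S] by blast
    note transfer = elem_carrier_update[OF H(2)] of_integer_carrier_update_6
    have "\<guillemotleft>6\<guillemotright>\<^bsub>R\<^esub> \<in> H"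
      using ring.of_int_closed[OF cring.axioms(1)[OF H(3)], of 6]
      by (simp add: of_integer_carrier_update_6)
    then obtain p q v where pqv: "idempotent_elem (R\<lparr>carrier := H\<rparr>) p"
        "idempotent_elem (R\<lparr>carrier := H\<rparr>) q" "nilpotent_elem (R\<lparr>carrier := H\<rparr>) v"
        "a = p \<oplus>\<^bsub>R\<^esub> q \<oplus>\<^bsub>R\<^esub> v"
      using cring.two_idempotents_plus_nilpotent_if_two_idempotent[OF H(3), of e w] H(1) ew a
        six_nilpotent_if_two_idempotent_plus_nilpotent[OF dec]
      by (auto simp: transfer)
    then have "commuting_elems R p q" "commuting_elems R p v" "commuting_elems R q v"
      using comm_monoid.m_comm[OF cring.axioms(2)[OF H(3)]]
      by (simp_all add: transfer commuting_elems_def)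
    with pqv show "\<exists>e f w. idempotent_elem R e \<and> idempotent_elem R f \<and> nilpotent_elem R w \<and>
        commuting_elems R e f \<and> commuting_elems R e w \<and> commuting_elems R f w \<and>
        a = e \<oplus>\<^bsub>R\<^esub> f \<oplus>\<^bsub>R\<^esub> w"
      by (auto simp: transfer)
  qed
qed

end
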